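(* Let $P$ be a finite poset, let $L=\mathcal{I}(P)$ be its lattice of order ideals, and let $G_L$ be the comparability graph of $L$. Let $P'$ be the subset of all elements of $P$ which are comparable to every element of $P$, and let $P''$ be the induced subposet of $P$ on the set $P\setminus P'$. Then $G_L$ is chordal if and only if $P$ is a chain or $P''$ is a disjoint union of a chain and an isolated element.
   Context: All posets are finite. $\mathcal{I}(P)$ is the distributive lattice of order ideals (down-closed subsets, including $\emptyset$ and $P$) of $P$, ordered by inclusion. The comparability graph $G_Q$ of a poset $Q$ is the simple graph on the underlying set of $Q$ in which $\{x,y\}$ ($x\ne y$) is an edge if and only if $x$ and $y$ are comparable in $Q$. A graph is chordal if every cycle of length at least $4$ has a chord, i.e. an edge joining two nonconsecutive vertices of the cycle. "Disjoint union" of posets means there are no relations between elements of the different pieces; the chain is nonempty. *)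

theory Defs
  imports Main
begin

text \<open>
  A poset is a carrier set together with its (non-strict) order relation, as in
  \<^const>\<open>partial_order_on\<close>; a chain is a carrier with \<^const>\<open>linear_order_on\<close>, which allows
  the empty carrier. A simple graph is a vertex set together with a set of two-element edges.
\<close>

type_synonym 'v sgraph = "'v set \<times> 'v set set"

definition comparable :: "'a rel \<Rightarrow> 'a \<Rightarrow> 'a \<Rightarrow> bool" where
  "comparable r x y \<longleftrightarrow> (x, y) \<in> r \<or> (y, x) \<in> r"

definition order_ideals :: "'a set \<Rightarrow> 'a rel \<Rightarrow> 'a set set" where
  "order_ideals P r = {I. I \<subseteq> P \<and> (\<forall>x\<in>I. \<forall>y\<in>P. (y, x) \<in> r \<longrightarrow> y \<in> I)}"

definition ideal_order :: "'a set \<Rightarrow> 'a rel \<Rightarrow> 'a set rel" where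
  "ideal_order P r = relation_of (\<subseteq>) (order_ideals P r)"

definition comparability_graph :: "'a set \<Rightarrow> 'a rel \<Rightarrow> 'a sgraph" where
  "comparability_graph Q r =
     (Q, {{x, y} | x y. x \<in> Q \<and> y \<in> Q \<and> x \<noteq> y \<and> comparable r x y})"

text \<open>
  A cycle is given by the list of its vertices, each listed once; the last vertex is
  joined back to the first.
\<close>

definition is_cycle :: "'v sgraph \<Rightarrow> 'v list \<Rightarrow> bool" where
  "is_cycle G vs \<longleftrightarrow>
     3 \<le> length vs \<and> distinct vs \<and> set vs \<subseteq> fst G \<and>
     (\<forall>i < length vs. {vs ! i, vs ! (Suc i mod length vs)} \<in> snd G)"

definition has_chord :: "'v sgraph \<Rightarrow> 'v list \<Rightarrow> bool" where
  "has_chord G vs \<longleftrightarrow>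
     (\<exists>i < length vs. \<exists>j < length vs. i \<noteq> j \<and>
        j \<noteq> Suc i mod length vs \<and> i \<noteq> Suc j mod length vs \<and> {vs ! i, vs ! j} \<in> snd G)"

definition chordal :: "'v sgraph \<Rightarrow> bool" where
  "chordal G \<longleftrightarrow> (\<forall>vs. is_cycle G vs \<and> 4 \<le> length vs \<longrightarrow> has_chord G vs)"

definition disjoint_union_of :: "'a set \<Rightarrow> 'a rel \<Rightarrow> 'a set \<Rightarrow> 'a set \<Rightarrow> bool" where
  "disjoint_union_of Q r A B \<longleftrightarrow>
     A \<union> B = Q \<and> A \<inter> B = {} \<and> (\<forall>a\<in>A. \<forall>b\<in>B. \<not> comparable r a b)"

definition chain_plus_isolated :: "'a set \<Rightarrow> 'a rel \<Rightarrow> bool" where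
  "chain_plus_isolated Q r \<longleftrightarrow>
     (\<exists>C x. C \<noteq> {} \<and> linear_order_on C (Restr r C) \<and> disjoint_union_of Q r C {x})"

definition comparable_to_all :: "'a set \<Rightarrow> 'a rel \<Rightarrow> 'a set" where
  "comparable_to_all P r = {x \<in> P. \<forall>y\<in>P. comparable r x y}"

end

(*
  Write a || b for incomparability. If x || y and u || v and neither u nor v lies below x or y, then
  the principal ideals of x and y together with the largest ideals avoiding u and v form
  a chordless 4-cycle. An antichain of size three gives the chordless 6-cycle of its proper
  nonempty joins. Excluding both makes any two incomparable pairs meet without forming a
  triangle, so all of them share one element x, i.e. P - {x} is a chain. Conversely, if P - {x}
  is a chain then the ideals containing x and the ideals avoiding x are two cliques covering the
  comparability graph; this rules out long chordless cycles by pigeonhole, and 4-cycles directly.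
*)

theory Submission
  imports Defs
begin

section \<open>Edges and short cycles in the comparability graph\<close>

abbreviation ideal_graph :: "'a set \<Rightarrow> 'a rel \<Rightarrow> 'a set sgraph" where
  "ideal_graph P r \<equiv> comparability_graph (order_ideals P r) (ideal_order P r)"

lemma ideal_graph_edge_iff:
  "{I, J} \<in> snd (ideal_graph P r) \<longleftrightarrow>
     I \<in> order_ideals P r \<and> J \<in> order_ideals P r \<and> I \<noteq> J \<and> (I \<subseteq> J \<or> J \<subseteq> I)"
  by (auto simp: comparability_graph_def comparable_def ideal_order_def relation_of_def
      doubleton_eq_iff)

lemma is_cycle_4I:
  assumes "distinct [a, b, c, d]" "{a, b, c, d} \<subseteq> fst G"
    and "{{a, b}, {b, c}, {c, d}, {d, a}} \<subseteq> snd G"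
  shows "is_cycle G [a, b, c, d]"
  using assms unfolding is_cycle_def by (simp add: All_less_Suc del: distinct.simps)

lemma has_chord_4D:
  assumes "has_chord G [a, b, c, d]"
  shows "{a, c} \<in> snd G \<or> {b, d} \<in> snd G"
proof -
  \<comment> \<open>Chords range over ordered index pairs, so each diagonal turns up in both
    orientations.\<close>
  have "{c, a} = {a, c}" "{d, b} = {b, d}"
    by auto
  then show ?thesis
    using assms unfolding has_chord_def by (simp add: Ex_less_Suc disj_ac)
qed

lemma is_cycle_6I:
  assumes "distinct [a, b, c, d, e, f]" "{a, b, c, d, e, f} \<subseteq> fst G"
    and "{{a, b}, {b, c}, {c, d}, {d, e}, {e, f}, {f, a}} \<subseteq> snd G"
  shows "is_cycle G [a, b, c, d, e, f]"
  using assms unfolding is_cycle_def by (simp add: All_less_Suc del: distinct.simps)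

lemma has_chord_6D:
  assumes "has_chord G [a, b, c, d, e, f]"
  shows "{a, c} \<in> snd G \<or> {a, d} \<in> snd G \<or> {a, e} \<in> snd G \<or> {b, d} \<in> snd G \<or>
     {b, e} \<in> snd G \<or> {b, f} \<in> snd G \<or> {c, e} \<in> snd G \<or> {c, f} \<in> snd G \<or> {d, f} \<in> snd G"
proof -
  have "{c, a} = {a, c}" "{d, a} = {a, d}" "{e, a} = {a, e}" "{d, b} = {b, d}" "{e, b} = {b, e}"
    "{f, b} = {b, f}" "{e, c} = {c, e}" "{f, c} = {c, f}" "{f, d} = {d, f}"
    by auto
  then show ?thesis
    using assms unfolding has_chord_def by (simp add: Ex_less_Suc disj_ac)
qed

text \<open>Go round as \<open>A, C, B, D\<close>: every lower set lies in every upper set, which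
  gives the four edges, while the diagonals pair lower with lower and upper with upper.\<close>

lemma chordal_imp_no_crossing:
  assumes "chordal (ideal_graph P r)"
    and "{A, B, C, D} \<subseteq> order_ideals P r"
    and "A \<union> B \<subseteq> C \<inter> D" and "\<not> A \<subseteq> B" "\<not> B \<subseteq> A" "\<not> C \<subseteq> D" "\<not> D \<subseteq> C"
  shows False
proof -
  let ?G = "ideal_graph P r" and ?vs = "[A, C, B, D]"
  have "distinct ?vs"
    using assms(3-7) by auto
  moreover have "{{A, C}, {C, B}, {B, D}, {D, A}} \<subseteq> snd ?G"
    unfolding insert_subset ideal_graph_edge_iff using assms(2-7) by blast
  ultimately have "is_cycle ?G ?vs"
    using is_cycle_4I [of A C B D ?G] assms(2) by (simp add: comparability_graph_def)
  then have "has_chord ?G ?vs"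
    using assms(1) by (simp add: chordal_def)
  then show False
    using has_chord_4D [of ?G A C B D] assms(4-7) unfolding ideal_graph_edge_iff by blast
qed

text \<open>The private elements \<open>x\<close>, \<open>y\<close>, \<open>z\<close> make the
  inclusions along the cycle proper and refute both inclusions on each of the nine
  diagonals.\<close>

lemma chordal_imp_no_hexagon:
  assumes "chordal (ideal_graph P r)"
    and "{X, Y, Z, X \<union> Y, Y \<union> Z, X \<union> Z} \<subseteq> order_ideals P r"
    and xyz: "x \<in> X - (Y \<union> Z)" "y \<in> Y - (X \<union> Z)" "z \<in> Z - (X \<union> Y)"
  shows False
proof -
  let ?G = "ideal_graph P r" and ?vs = "[X, X \<union> Y, Y, Y \<union> Z, Z, X \<union> Z]"
  have "distinct ?vs"
    using xyz by auto
  moreover have "{X, X \<union> Y} \<in> snd ?G" "{X \<union> Y, Y} \<in> snd ?G" "{Y, Y \<union> Z} \<in> snd ?G"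
    "{Y \<union> Z, Z} \<in> snd ?G" "{Z, X \<union> Z} \<in> snd ?G" "{X \<union> Z, X} \<in> snd ?G"
    unfolding ideal_graph_edge_iff using assms(2) xyz by auto
  ultimately have "is_cycle ?G ?vs"
    using assms(2) by (intro is_cycle_6I) (simp_all add: comparability_graph_def)
  then have "has_chord ?G ?vs"
    using assms(1) by (simp add: chordal_def)
  moreover have "{X, Y} \<notin> snd ?G" "{X, Y \<union> Z} \<notin> snd ?G" "{X, Z} \<notin> snd ?G"
    "{X \<union> Y, Y \<union> Z} \<notin> snd ?G" "{X \<union> Y, Z} \<notin> snd ?G" "{X \<union> Y, X \<union> Z} \<notin> snd ?G"
    "{Y, Z} \<notin> snd ?G" "{Y, X \<union> Z} \<notin> snd ?G" "{Y \<union> Z, X \<union> Z} \<notin> snd ?G"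
    unfolding ideal_graph_edge_iff using xyz by auto
  ultimately show False
    using has_chord_6D [of ?G X "X \<union> Y" Y "Y \<union> Z" Z "X \<union> Z"] by simp
qed

section \<open>Incomparable pairs when the graph is chordal\<close>

lemma order_ideals_Un:
  "I \<in> order_ideals P r \<Longrightarrow> J \<in> order_ideals P r \<Longrightarrow> I \<union> J \<in> order_ideals P r"
  by (auto simp: order_ideals_def)

lemma principal_ideal:
  "trans r \<Longrightarrow> {p \<in> P. (p, x) \<in> r} \<in> order_ideals P r"
  by (auto simp: order_ideals_def dest: transD)

lemma avoiding_ideal:
  "trans r \<Longrightarrow> {p \<in> P. (x, p) \<notin> r} \<in> order_ideals P r"
  by (auto simp: order_ideals_def dest: transD)

context
  fixes P :: "'a set" and r :: "'a rel"
  assumes po: "partial_order_on P r"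
begin

lemma poset_facts:
  shows "trans r" and "x \<in> P \<Longrightarrow> (x, x) \<in> r" and "antisym r" and "r \<subseteq> P \<times> P"
  using po by (auto simp: partial_order_on_def preorder_on_def refl_on_def)

lemma chordal_imp_below:
  assumes "chordal (ideal_graph P r)"
    and "x \<in> P" "y \<in> P" "\<not> comparable r x y" and "u \<in> P" "v \<in> P" "\<not> comparable r u v"
  shows "(u, x) \<in> r \<or> (u, y) \<in> r \<or> (v, x) \<in> r \<or> (v, y) \<in> r"
proof (rule ccontr)
  assume no: "\<not> ?thesis"
  let ?A = "{p \<in> P. (p, x) \<in> r}" and ?B = "{p \<in> P. (p, y) \<in> r}"
  let ?C = "{p \<in> P. (u, p) \<notin> r}" and ?D = "{p \<in> P. (v, p) \<notin> r}"
  have "{?A, ?B, ?C, ?D} \<subseteq> order_ideals P r"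
    by (simp add: principal_ideal avoiding_ideal poset_facts(1))
  \<comment> \<open>A point above \<open>u\<close> and below \<open>x\<close> would put
    \<open>u\<close> below \<open>x\<close>; likewise for the other three combinations.\<close>
  moreover have "?A \<union> ?B \<subseteq> ?C \<inter> ?D"
    using no poset_facts(1) by (auto dest: transD)
  \<comment> \<open>\<open>x\<close> and \<open>y\<close> separate \<open>?A\<close> from
    \<open>?B\<close>; \<open>v\<close> lies in \<open>?C\<close> but not in \<open>?D\<close>, and
    \<open>u\<close> in \<open>?D\<close> but not in \<open>?C\<close>.\<close>
  moreover have "\<not> ?A \<subseteq> ?B" "\<not> ?B \<subseteq> ?A" "\<not> ?C \<subseteq> ?D" "\<not> ?D \<subseteq> ?C"
    using assms(2-7) poset_facts(2) unfolding comparable_def by blast+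
  ultimately show False
    by (rule chordal_imp_no_crossing [OF assms(1)])
qed

text \<open>Each of the three elements is private to its own principal ideal, so these ideals span a
  hexagon.\<close>

lemma chordal_imp_no_3_antichain:
  assumes "chordal (ideal_graph P r)" and "x \<in> P" "y \<in> P" "z \<in> P"
    and "\<not> comparable r x y" "\<not> comparable r y z" "\<not> comparable r x z"
  shows False
proof -
  let ?D = "\<lambda>x. {p \<in> P. (p, x) \<in> r}"
  have "{?D x, ?D y, ?D z, ?D x \<union> ?D y, ?D y \<union> ?D z, ?D x \<union> ?D z} \<subseteq> order_ideals P r"
    by (simp add: principal_ideal order_ideals_Un poset_facts(1))
  then show False
    using chordal_imp_no_hexagon [OF assms(1), of "?D x" "?D y" "?D z" x y z]
      assms(2-7) poset_facts(2) by (auto simp: comparable_def)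
qed

text \<open>If two disjoint incomparable pairs existed, applying the previous bound both ways
  would give a copy of 2 + 2, whose minimal pair and maximal pair contradict that bound.\<close>

lemma chordal_imp_pairs_meet:
  assumes "chordal (ideal_graph P r)"
    and "x \<in> P" "y \<in> P" "\<not> comparable r x y" and "u \<in> P" "v \<in> P" "\<not> comparable r u v"
  shows "{x, y} \<inter> {u, v} \<noteq> {}"
proof
  assume disj: "{x, y} \<inter> {u, v} = {}"
  have main: False
    if "x \<in> P" "y \<in> P" "u \<in> P" "v \<in> P" "\<not> comparable r x y" "\<not> comparable r u v"
      "(u, x) \<in> r" "u \<noteq> x" "y \<noteq> v" for x y u v
  proof -
    have tr: "\<And>a b c. (a, b) \<in> r \<Longrightarrow> (b, c) \<in> r \<Longrightarrow> (a, c) \<in> r"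
      using poset_facts(1) by (blast dest: transD)
    have as: "\<And>a b. (a, b) \<in> r \<Longrightarrow> (b, a) \<in> r \<Longrightarrow> a = b"
      using poset_facts(3) by (blast dest: antisymD)
    \<comment> \<open>The other alternatives fail: \<open>x\<close> below \<open>u\<close> breaks
      antisymmetry, \<open>x\<close> below \<open>v\<close> makes \<open>u, v\<close> comparable,
      and \<open>y\<close> below \<open>u\<close> makes \<open>x, y\<close> comparable.\<close>
    have "(y, v) \<in> r"
      using chordal_imp_below [OF assms(1), of u v x y] that tr as
      unfolding comparable_def by blast
    then have "\<not> comparable r x v" "\<not> comparable r u y"
      "(x, u) \<notin> r" "(x, y) \<notin> r" "(v, u) \<notin> r" "(v, y) \<notin> r"
      using that tr as unfolding comparable_def by blast+
    then show False
      using chordal_imp_below [OF assms(1), of u y x v] that by blast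
  qed
  \<comment> \<open>Symmetry lets \<open>main\<close> cover all four cases by exchanging
    \<open>x\<close> with \<open>y\<close> or \<open>u\<close> with \<open>v\<close>.\<close>
  have sym: "\<not> comparable r y x" "\<not> comparable r v u"
    using assms by (auto simp: comparable_def)
  consider "(u, x) \<in> r" | "(u, y) \<in> r" | "(v, x) \<in> r" | "(v, y) \<in> r"
    using chordal_imp_below [OF assms] by blast
  then show False
  proof cases
    case 1 then show ?thesis using main [of x y u v] assms sym disj by blast
  next
    case 2 then show ?thesis using main [of y x u v] assms sym disj by blast
  next
    case 3 then show ?thesis using main [of x y v u] assms sym disj by blast
  next
    case 4 then show ?thesis using main [of y x v u] assms sym disj by blast
  qed
qed

text \<open>Pairwise intersecting edges form a star or a triangle, and a triangle of incomparable
  pairs is an antichain of size three. A centre of the star can be found on the given edge.\<close>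

lemma chordal_imp_common_element:
  assumes ch: "chordal (ideal_graph P r)" and ab: "a \<in> P" "b \<in> P" "\<not> comparable r a b"
  shows "\<exists>x. (x = a \<or> x = b) \<and>
    (\<forall>u\<in>P. \<forall>v\<in>P. \<not> comparable r u v \<longrightarrow> u = x \<or> v = x)"
proof (rule ccontr)
  assume no: "\<not> ?thesis"
  have sym: "\<And>p q. comparable r p q \<longleftrightarrow> comparable r q p"
    by (auto simp: comparable_def)
  \<comment> \<open>A pair avoiding \<open>p\<close> must still meet the pair \<open>p, q\<close>,
    so it contains \<open>q\<close>; \<open>w\<close> is its other member.\<close>
  have pair: "\<exists>w. w \<in> P \<and> \<not> comparable r q w \<and> w \<noteq> p"
    if pq: "p \<in> P" "q \<in> P" "\<not> comparable r p q" "p = a \<or> p = b" for p q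
  proof -
    obtain u v where uv: "u \<in> P" "v \<in> P" "\<not> comparable r u v" "u \<noteq> p" "v \<noteq> p"
      using no pq(4) by blast
    then have "u = q \<or> v = q"
      using chordal_imp_pairs_meet [OF ch pq(1-3) uv(1-3)] by blast
    then show ?thesis
      using uv sym by metis
  qed
  obtain c where c: "c \<in> P" "\<not> comparable r b c" "c \<noteq> a"
    using pair [of a b] ab by blast
  obtain d where d: "d \<in> P" "\<not> comparable r a d" "d \<noteq> b"
    using pair [of b a] ab sym by blast
  have "a \<noteq> b"
    using ab poset_facts(2) by (auto simp: comparable_def)
  \<comment> \<open>The pairs \<open>b, c\<close> and \<open>a, d\<close> meet, and only
    \<open>c = d\<close> allows that; then \<open>a, b, c\<close> is the forbidden triangle.\<close>
  then have "c = d"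
    using chordal_imp_pairs_meet [OF ch ab(2) c(1,2) ab(1) d(1,2)] c d by blast
  then show False
    using chordal_imp_no_3_antichain [OF ch ab(1,2) c(1) ab(3) c(2)] d by blast
qed

lemma chordal_imp_chain_plus_isolated:
  assumes ch: "chordal (ideal_graph P r)" and nl: "\<not> linear_order_on P r"
    and Q: "Q = P - comparable_to_all P r"
  shows "chain_plus_isolated Q (Restr r Q)"
proof -
  have sym: "\<And>p q. comparable r p q \<longleftrightarrow> comparable r q p"
    by (auto simp: comparable_def)
  obtain a b where ab: "a \<in> P" "b \<in> P" "\<not> comparable r a b"
    using nl po by (auto simp: linear_order_on_def total_on_def comparable_def)
  obtain x where x: "x = a \<or> x = b"
    and cen: "\<And>u v. u \<in> P \<Longrightarrow> v \<in> P \<Longrightarrow> \<not> comparable r u v \<Longrightarrow> u = x \<or> v = x"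
    using chordal_imp_common_element [OF ch ab] by blast
  \<comment> \<open>As every incomparable pair contains \<open>x\<close>, the elements of
    \<open>P - {x}\<close> outside \<open>C\<close> are comparable to everything, and
    \<open>C\<close> itself is a chain.\<close>
  define C where "C = {p \<in> P. \<not> comparable r p x}"
  have xP: "x \<in> P" and xx: "comparable r x x"
    using x ab poset_facts(2) by (auto simp: comparable_def)
  have "C \<noteq> {}"
    using x ab sym unfolding C_def by blast
  moreover have QC: "Q = C \<union> {x}"
    using cen xP x ab sym unfolding Q C_def comparable_to_all_def by blast
  have "linear_order_on C (Restr r C)"
  proof -
    have "total_on C (Restr r C)"
      using cen xx unfolding total_on_def C_def comparable_def by blast
    then show ?thesis
      using poset_facts unfolding linear_order_on_def partial_order_on_def preorder_on_def
      by (auto simp: refl_on_def C_def intro: trans_Restr antisym_subset)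
  qed
  moreover have "Restr (Restr r Q) C = Restr r C"
    using QC by auto
  moreover have "disjoint_union_of Q (Restr r Q) C {x}"
    using QC xx unfolding disjoint_union_of_def C_def comparable_def by auto
  ultimately show ?thesis
    unfolding chain_plus_isolated_def by metis
qed

end

section \<open>Chordality when all but one element form a chain\<close>

text \<open>A missing edge alone would allow equal ideals; distinctness of the cycle's vertices
  excludes that.\<close>

lemma not_has_chordD:
  assumes "\<not> has_chord (ideal_graph P r) vs" and "is_cycle (ideal_graph P r) vs"
    and "i < length vs" "j < length vs" "i \<noteq> j"
    and "j \<noteq> Suc i mod length vs" "i \<noteq> Suc j mod length vs"
  shows "\<not> vs ! i \<subseteq> vs ! j" "\<not> vs ! j \<subseteq> vs ! i"
proof -
  have "vs ! i \<in> order_ideals P r" "vs ! j \<in> order_ideals P r" "vs ! i \<noteq> vs ! j"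
    using assms(2-5)
    by (auto simp: is_cycle_def comparability_graph_def nth_eq_iff_index_eq)
  moreover have "{vs ! i, vs ! j} \<notin> snd (ideal_graph P r)"
    using assms by (auto simp: has_chord_def)
  ultimately show "\<not> vs ! i \<subseteq> vs ! j" "\<not> vs ! j \<subseteq> vs ! i"
    by (auto simp: ideal_graph_edge_iff)
qed

text \<open>For \<open>p\<close> in \<open>D\<close> and only in \<open>I\<close>, and
  \<open>q\<close> in \<open>D\<close> and only in \<open>J\<close>, down-closure fails whichever of
  the two is below the other.\<close>

lemma chain_imp_ideals_nested:
  assumes "I \<in> order_ideals P r" "J \<in> order_ideals P r"
    and "\<And>p q. p \<in> D \<Longrightarrow> q \<in> D \<Longrightarrow> comparable r p q" and "D \<subseteq> P"
  shows "I \<inter> D \<subseteq> J \<or> J \<inter> D \<subseteq> I"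
  using assms unfolding order_ideals_def comparable_def by blast

lemma chordal_if_chain_except:
  assumes chain: "\<And>p q. p \<in> P - {x} \<Longrightarrow> q \<in> P - {x} \<Longrightarrow> comparable r p q"
  shows "chordal (ideal_graph P r)"
  unfolding chordal_def
proof (intro allI impI, elim conjE, rule ccontr)
  fix vs :: "'a set list"
  let ?n = "length vs" and ?G = "ideal_graph P r"
  assume cyc: "is_cycle ?G vs" and n: "4 \<le> ?n" and nc: "\<not> has_chord ?G vs"
  have sub: "I \<subseteq> P" if "I \<in> order_ideals P r" for I
    using that by (auto simp: order_ideals_def)
  have id: "vs ! i \<in> order_ideals P r" if "i < ?n" for i
    using cyc that by (auto simp: is_cycle_def comparability_graph_def)
  have nest: "I \<inter> (P - {x}) \<subseteq> J \<or> J \<inter> (P - {x}) \<subseteq> I"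
    if "I \<in> order_ideals P r" "J \<in> order_ideals P r" for I J
    using chain_imp_ideals_nested [OF that chain] by blast
  \<comment> \<open>Nonconsecutive vertices are incomparable yet nested off \<open>x\<close>, so
    exactly one of them contains \<open>x\<close>.\<close>
  have bit: "x \<in> vs ! i \<longleftrightarrow> x \<notin> vs ! j"
    if "i < ?n" "j < ?n" "i \<noteq> j" "j \<noteq> Suc i mod ?n" "i \<noteq> Suc j mod ?n" for i j
    using not_has_chordD [OF nc cyc that] nest [OF id id, OF that(1,2)]
      sub [OF id, OF that(1)] sub [OF id, OF that(2)]
    by blast
  have adj: "vs ! i \<subseteq> vs ! (Suc i mod ?n) \<or> vs ! (Suc i mod ?n) \<subseteq> vs ! i" if "i < ?n" for i
    using cyc that unfolding is_cycle_def ideal_graph_edge_iff by blast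
  \<comment> \<open>By \<open>bit\<close>, membership of \<open>x\<close> 2-colours the graph of
    nonconsecutive pairs. From length 5 on that graph has an odd cycle; at length 4 it is two
    disjoint diagonals, so the edges are needed too.\<close>
  consider "?n = 4" | "?n = 5" | "?n \<ge> 6"
    using n by linarith
  then show False
  proof cases
    case 1
    have suc: "Suc 0 mod ?n = 1" "Suc 1 mod ?n = 2" "Suc 2 mod ?n = 3" "Suc 3 mod ?n = 0"
      and lt: "0 < ?n" "1 < ?n" "2 < ?n" "3 < ?n"
      using 1 by simp_all
    have e: "vs!0 \<subseteq> vs!1 \<or> vs!1 \<subseteq> vs!0" "vs!1 \<subseteq> vs!2 \<or> vs!2 \<subseteq> vs!1"
      "vs!2 \<subseteq> vs!3 \<or> vs!3 \<subseteq> vs!2" "vs!3 \<subseteq> vs!0 \<or> vs!0 \<subseteq> vs!3"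
      using adj [OF lt(1)] adj [OF lt(2)] adj [OF lt(3)] adj [OF lt(4)] unfolding suc .
    \<comment> \<open>The end of a diagonal without \<open>x\<close> must be the larger one off
      \<open>x\<close>, or it would be contained in the other end.\<close>
    have cross: "vs!i - {x} \<subseteq> vs!j \<and> x \<notin> vs!j \<and> \<not> vs!j \<subseteq> vs!i"
      if ij: "(i, j) \<in> {(0, 2), (2, 0), (1, 3), (3, 1)}" and xi: "x \<in> vs!i" for i j
    proof -
      have lt: "i < ?n" "j < ?n"
        and nonadj: "i \<noteq> j" "j \<noteq> Suc i mod ?n" "i \<noteq> Suc j mod ?n"
        using ij 1 by auto
      have "x \<notin> vs!j" "\<not> vs!j \<subseteq> vs!i"
        using bit [OF lt nonadj] not_has_chordD [OF nc cyc lt nonadj] xi by auto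
      then show ?thesis
        using nest [OF id id, OF lt] sub [OF id, OF lt(1)] sub [OF id, OF lt(2)] by blast
    qed
    \<comment> \<open>Outside \<open>x\<close>, the sets would satisfy c below b below d below a below c.\<close>
    have no4: False
      if "x \<in> a" "x \<in> b" "a - {x} \<subseteq> c \<and> x \<notin> c \<and> \<not> c \<subseteq> a" "b - {x} \<subseteq> d \<and> x \<notin> d \<and> \<not> d \<subseteq> b"
        "b \<subseteq> c \<or> c \<subseteq> b" "d \<subseteq> a \<or> a \<subseteq> d" for a b c d
      using that by blast
    have "x \<in> vs!0 \<longleftrightarrow> x \<notin> vs!2" "x \<in> vs!1 \<longleftrightarrow> x \<notin> vs!3"
      using bit [of 0 2] bit [of 1 3] 1 by auto
    \<comment> \<open>Each diagonal has exactly one end containing \<open>x\<close>, so the two such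
      vertices are consecutive; the cases are rotations of one another.\<close>
    then consider "x \<in> vs!0" "x \<in> vs!1" | "x \<in> vs!1" "x \<in> vs!2"
      | "x \<in> vs!2" "x \<in> vs!3" | "x \<in> vs!3" "x \<in> vs!0"
      by blast
    then show ?thesis
    proof cases
      case 1
      then show ?thesis
        using no4 [of "vs!0" "vs!1" "vs!2" "vs!3"] cross [of 0 2] cross [of 1 3] e by simp
    next
      case 2
      then show ?thesis
        using no4 [of "vs!1" "vs!2" "vs!3" "vs!0"] cross [of 1 3] cross [of 2 0] e by simp
    next
      case 3
      then show ?thesis
        using no4 [of "vs!2" "vs!3" "vs!0" "vs!1"] cross [of 2 0] cross [of 3 1] e by simp
    next
      case 4
      then show ?thesis
        using no4 [of "vs!3" "vs!0" "vs!1" "vs!2"] cross [of 3 1] cross [of 0 2] e by simp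
    qed
  next
    case 2
    \<comment> \<open>The diagonals form the 5-cycle 0, 2, 4, 1, 3.\<close>
    then show ?thesis
      using bit [of 0 2] bit [of 2 4] bit [of 4 1] bit [of 1 3] bit [of 3 0] by auto
  next
    case 3
    \<comment> \<open>The odd cycle is the triangle 0, 2, 4; length at least 6 keeps 4 and 0
      nonconsecutive.\<close>
    then have "Suc 0 mod ?n = 1" "Suc 2 mod ?n = 3" "Suc 4 mod ?n = 5"
      and "0 < ?n" "2 < ?n" "4 < ?n"
      by auto
    then show ?thesis
      using bit [of 0 2] bit [of 2 4] bit [of 0 4] by force
  qed
qed

theorem corollary5p8:
  fixes P :: "'a set" and r :: "'a rel"
  assumes "finite P" and "partial_order_on P r"
  shows "chordal (comparability_graph (order_ideals P r) (ideal_order P r)) \<longleftrightarrow>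
           linear_order_on P r \<or>
           (let P'' = P - comparable_to_all P r
            in chain_plus_isolated P'' (Restr r P''))"
proof -
  define Q where "Q = P - comparable_to_all P r"
  have refl: "(p, p) \<in> r" if "p \<in> P" for p
    using assms(2) that by (auto simp: partial_order_on_def preorder_on_def refl_on_def)
  \<comment> \<open>A chain stays a chain without any one element, so the exceptional element is
    arbitrary.\<close>
  have "chordal (ideal_graph P r)" if "linear_order_on P r"
    using that refl
    by (intro chordal_if_chain_except [where x = undefined])
      (metis DiffD1 comparable_def linear_order_on_def total_on_def)
  moreover have "chordal (ideal_graph P r)" if cpi: "chain_plus_isolated Q (Restr r Q)"
  proof -
    obtain C x where C: "linear_order_on C (Restr (Restr r Q) C)" "C \<union> {x} = Q"
      using cpi by (auto simp: chain_plus_isolated_def disjoint_union_of_def)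
    then have "comparable r p q" if "p \<in> C" "q \<in> C" for p q
      using that refl [of p] Q_def
      by (cases "p = q") (auto simp: linear_order_on_def total_on_def comparable_def)
    moreover have "comparable r p q \<and> comparable r q p"
      if "p \<in> comparable_to_all P r" "q \<in> P" for p q
      using that by (auto simp: comparable_to_all_def comparable_def)
    \<comment> \<open>Since \<open>C \<union> {x}\<close> is the complement of
      \<open>comparable_to_all P r\<close> in \<open>P\<close>, each of \<open>p\<close> and
      \<open>q\<close> lies in \<open>C\<close> or is comparable to everything.\<close>
    ultimately have "comparable r p q" if "p \<in> P - {x}" "q \<in> P - {x}" for p q
      using that C(2) Q_def by blast
    then show ?thesis
      by (rule chordal_if_chain_except)
  qed
  ultimately show ?thesis
    using chordal_imp_chain_plus_isolated [OF assms(2) _ _ Q_def] unfolding Let_def Q_def by blast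
qed

end
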